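(* Let $N\ge1$ be an integer, $a>0$, and let $P_n^*(x)$ and $g_N=g_N(x)$ be as in the context. For any integers $k\ge0$ and $j\ge1$, $$P_{k+jN}^*(x)=P_{k+N}^*(x)\,U_{j-1}(g_N)-P_k^*(x)\,U_{j-2}(g_N).$$
   Context: Let $q=e^{2\pi i/N}$, so $a(q^n+q^{-n})=2a\cos(2\pi n/N)$. The polynomials $P_n(x)$ are defined by $P_0(x)=1$, $P_1(x)=2x-2a$ and $$2xP_n(x)=P_{n+1}(x)+a(q^n+q^{-n})P_n(x)+P_{n-1}(x),\quad n\ge1.$$ The numerator polynomials $P_n^*(x)$ are defined by the same recurrence for $n\ge 1$ with $P_0^*(x)=0$ and $P_1^*(x)=2$. The polynomial $g_N$ is $$g_N(x)=\frac{P_N(x)-P_{N-1}^*(x)/2}{2}.$$ $U_n$ denotes the Chebyshev polynomial of the second kind, $U_0(x)=1$, $U_1(x)=2x$, $U_{n+1}(x)=2xU_n(x)-U_{n-1}(x)$, with the convention $U_{-1}=0$. *)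

theory Defs
  imports Complex_Main "HOL-Computational_Algebra.Polynomial"
begin

definition qroot :: "nat \<Rightarrow> complex" where
  "qroot N = exp (2 * of_real pi * \<i> / of_nat N)"

definition diag_coeff :: "nat \<Rightarrow> real \<Rightarrow> nat \<Rightarrow> complex" where
  "diag_coeff N a n = of_real a * (qroot N ^ n + inverse (qroot N) ^ n)"

text \<open>Polynomials in \<open>x\<close> are elements of \<^typ>\<open>complex poly\<close>, with \<open>2x\<close> written as
  \<^term>\<open>[:0, 2:]\<close>. The recurrence
  \<open>2x y\<^sub>n = y\<^sub>n\<^sub>+\<^sub>1 + a (q\<^sup>n + q\<^sup>-\<^sup>n) y\<^sub>n + y\<^sub>n\<^sub>-\<^sub>1\<close> (\<open>n \<ge> 1\<close>) is solved for \<open>y\<^sub>n\<^sub>+\<^sub>1\<close>.\<close>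

fun P :: "nat \<Rightarrow> real \<Rightarrow> nat \<Rightarrow> complex poly" where
  "P N a 0 = 1"
| "P N a (Suc 0) = [:- 2 * of_real a, 2:]"
| "P N a (Suc (Suc n)) =
     [:0, 2:] * P N a (Suc n) - smult (diag_coeff N a (Suc n)) (P N a (Suc n)) - P N a n"

fun Pstar :: "nat \<Rightarrow> real \<Rightarrow> nat \<Rightarrow> complex poly" where
  "Pstar N a 0 = 0"
| "Pstar N a (Suc 0) = 2"
| "Pstar N a (Suc (Suc n)) =
     [:0, 2:] * Pstar N a (Suc n) - smult (diag_coeff N a (Suc n)) (Pstar N a (Suc n)) - Pstar N a n"

definition g :: "nat \<Rightarrow> real \<Rightarrow> complex poly" where
  "g N a = smult (1 / 2) (P N a N - smult (1 / 2) (Pstar N a (N - 1)))"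

fun ChebU_nat :: "nat \<Rightarrow> complex poly" where
  "ChebU_nat 0 = 1"
| "ChebU_nat (Suc 0) = [:0, 2:]"
| "ChebU_nat (Suc (Suc n)) = [:0, 2:] * ChebU_nat (Suc n) - ChebU_nat n"

text \<open>Integer index, so that the convention \<open>U\<^sub>-\<^sub>1 = 0\<close> can be stated; the value at indices
  below \<open>-1\<close> is a dummy.\<close>

definition ChebU :: "int \<Rightarrow> complex poly" where
  "ChebU n = (if n < 0 then 0 else ChebU_nat (nat n))"

end

theory Submission
  imports Defs
begin

text \<open>The coefficients of the recurrence are \<open>N\<close>-periodic, so shifting a solution by \<open>N\<close> acts
  on the two-dimensional solution space by a monodromy matrix. Its trace is
  \<open>P\<^sub>N - P\<^sup>*\<^sub>N\<^sub>-\<^sub>1 / 2 = 2 g\<^sub>N\<close> and its determinant is \<open>1\<close>, being a ratio of Wronskians.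
  By Cayley--Hamilton, \<open>j \<mapsto> P\<^sup>*\<^sub>k\<^sub>+\<^sub>j\<^sub>N\<close> satisfies the recurrence of \<open>U\<^sub>j(g\<^sub>N)\<close>.\<close>

lemma qroot_power_self:
  assumes "N \<ge> 1"
  shows "qroot N ^ N = 1"
proof -
  have "qroot N ^ N = exp (of_nat N * (2 * of_real pi * \<i> / of_nat N))"
    unfolding qroot_def by (simp only: exp_of_nat_mult)
  also have "of_nat N * (2 * of_real pi * \<i> / of_nat N) = 2 * of_real pi * \<i>"
    using assms by simp
  finally show ?thesis
    by simp
qed

lemma diag_coeff_periodic:
  assumes "N \<ge> 1"
  shows "diag_coeff N a (n + N) = diag_coeff N a n"
  unfolding diag_coeff_def by (simp add: power_add power_inverse qroot_power_self[OF assms])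

text \<open>The right-hand side extends the initial values \<open>y\<^sub>N\<^sub>-\<^sub>1\<close>, \<open>y\<^sub>N\<close>: extended to index \<open>-1\<close> by the
  recurrence, \<open>(P\<^sub>-\<^sub>1, P\<^sub>0) = (0, 1)\<close> and \<open>(P\<^sup>*\<^sub>-\<^sub>1, P\<^sup>*\<^sub>0) = (-2, 0)\<close>. Both sides are doubled to
  avoid fractions.\<close>

lemma solution_shift:
  assumes N: "N \<ge> 1"
    and rec: "\<And>n. y (Suc (Suc n)) =
      [:0, 2:] * y (Suc n) - smult (diag_coeff N a (Suc n)) (y (Suc n)) - y n"
  shows "2 * y (n + N) = 2 * y N * P N a n - y (N - 1) * Pstar N a n"
proof (induction n rule: induct_nat_012)
  case 0
  show ?case by simp
next
  case 1
  obtain M where M: "N = Suc M" using N by (cases N) auto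
  \<comment> \<open>By periodicity this is the coefficient at index \<open>0\<close>, so
    \<open>P N a 1\<close> obeys the recurrence with \<open>P\<close> at index \<open>-1\<close>
    equal to \<open>0\<close>.\<close>
  have "diag_coeff N a N = 2 * of_real a"
    using diag_coeff_periodic[OF N, of a 0] by (simp add: diag_coeff_def)
  then have "y (Suc N) = [:- 2 * of_real a, 2:] * y N - y (N - 1)"
    using rec[of M] by (simp add: M)
  then show ?case
    by (simp only: P.simps Pstar.simps add_Suc add_0) (simp only: algebra_simps)
next
  case (ge2 n)
  \<comment> \<open>As a constant polynomial the coefficient enters ring normalisation as an
    ordinary factor.\<close>
  define c where "c = [:diag_coeff N a (Suc n):]"
  have c: "smult (diag_coeff N a (Suc n)) p = c * p" for p
    by (simp add: c_def)
  have "y (Suc (Suc n) + N) = [:0, 2:] * y (Suc n + N) - c * y (Suc n + N) - y (n + N)"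
    using rec[of "n + N"] diag_coeff_periodic[OF N, of a "Suc n"] by (simp add: c_def)
  then have "2 * y (Suc (Suc n) + N) =
      [:0, 2:] * (2 * y (Suc n + N)) - c * (2 * y (Suc n + N)) - 2 * y (n + N)"
    by (simp only:) (simp only: algebra_simps)
  then show ?case
    unfolding ge2.IH P.simps Pstar.simps c by (simp only: algebra_simps)
qed

text \<open>The terms with the diagonal coefficient cancel and the oldest term has coefficient
  \<open>-1\<close>, so the value is the one at \<open>n = 0\<close>.\<close>

lemma wronskian: "P N a n * Pstar N a (Suc n) - P N a (Suc n) * Pstar N a n = 2"
proof (induction n)
  case 0
  show ?case by simp
next
  case (Suc n)
  define c where "c = [:diag_coeff N a (Suc n):]"
  have c: "smult (diag_coeff N a (Suc n)) p = c * p" for p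
    by (simp add: c_def)
  show ?case
    using Suc.IH unfolding P.simps Pstar.simps c by (simp only: algebra_simps)
qed

lemma four_g: "4 * g N a = 2 * P N a N - Pstar N a (N - 1)"
proof -
  have [simp]: "2 * p = smult 2 p" "4 * p = smult 4 p" for p :: "complex poly"
    by (simp_all add: numeral_poly)
  show ?thesis
    by (simp add: g_def smult_diff_right)
qed

text \<open>Cayley-Hamilton by elimination: shift twice, then remove \<open>P\<close>. The factor 4
  clears the halves from the two shifts.\<close>

lemma Pstar_double_shift:
  assumes N: "N \<ge> 1"
  shows "Pstar N a (n + 2 * N) = 2 * g N a * Pstar N a (n + N) - Pstar N a n"
proof -
  obtain M where M: "N = Suc M" using N by (cases N) auto
  have shiftP: "2 * P N a (m + N) = 2 * P N a N * P N a m - P N a (N - 1) * Pstar N a m" for m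
    by (rule solution_shift[OF N]) simp
  have shiftS: "2 * Pstar N a (m + N)
      = 2 * Pstar N a N * P N a m - Pstar N a (N - 1) * Pstar N a m" for m
    by (rule solution_shift[OF N]) simp
  have W: "P N a (N - 1) * Pstar N a N - P N a N * Pstar N a (N - 1) = 2"
    using wronskian[of N a M] by (simp only: M diff_Suc_1)
  have double: "2 * Pstar N a (n + 2 * N)
      = 2 * Pstar N a N * P N a (n + N) - Pstar N a (N - 1) * Pstar N a (n + N)"
    using shiftS[of "n + N"] by (simp only: mult_2[of N] add.assoc)
  have "4 * Pstar N a (n + 2 * N) = 2 * (2 * Pstar N a (n + 2 * N))"
    by simp
  also have "\<dots> = 2 * Pstar N a N * (2 * P N a (n + N))
      - 2 * Pstar N a (N - 1) * Pstar N a (n + N)"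
    unfolding double by (simp add: algebra_simps)
  also have "\<dots> = 2 * P N a N * (2 * Pstar N a N * P N a n)
      - 2 * Pstar N a N * P N a (N - 1) * Pstar N a n
      - 2 * Pstar N a (N - 1) * Pstar N a (n + N)"
    unfolding shiftP by (simp add: algebra_simps)
  \<comment> \<open>The first shift, solved for its \<open>P\<close> term, leaves only values of
    \<open>Pstar\<close> at \<open>n\<close> and \<open>n + N\<close>.\<close>
  also have "2 * Pstar N a N * P N a n
      = 2 * Pstar N a (n + N) + Pstar N a (N - 1) * Pstar N a n"
    unfolding shiftS by simp
  also have "2 * P N a N * (2 * Pstar N a (n + N) + Pstar N a (N - 1) * Pstar N a n)
      - 2 * Pstar N a N * P N a (N - 1) * Pstar N a n
      - 2 * Pstar N a (N - 1) * Pstar N a (n + N)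
      = 2 * (2 * P N a N - Pstar N a (N - 1)) * Pstar N a (n + N)
      - 2 * (P N a (N - 1) * Pstar N a N - P N a N * Pstar N a (N - 1)) * Pstar N a n"
    by (simp add: algebra_simps)
  \<comment> \<open>The two brackets are twice the trace, \<open>4 * g N a\<close>, and the
    Wronskian \<open>2\<close>.\<close>
  also have "\<dots> = 4 * (2 * g N a * Pstar N a (n + N) - Pstar N a n)"
    unfolding W four_g[symmetric] by (simp add: algebra_simps)
  finally have "4 * Pstar N a (n + 2 * N) = \<dots>" .
  then show ?thesis
    by (subst (asm) mult_cancel_left) simp
qed

lemma pcompose_ChebU_rec:
  "pcompose (ChebU (int j + 1)) p
    = 2 * p * pcompose (ChebU (int j)) p - pcompose (ChebU (int j - 1)) p"
proof -
  have X: "pcompose [:0, 2:] p = 2 * p"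
    by (simp add: pcompose_pCons numeral_poly)
  show ?thesis
  proof (cases j)
    \<comment> \<open>Here the convention that U has value \<open>0\<close> at index
      \<open>-1\<close> enters.\<close>
    case 0
    then show ?thesis by (simp add: ChebU_def X pcompose_1)
  next
    case (Suc i)
    then have "nat (int j + 1) = Suc (Suc i)" "nat (int j) = Suc i" "nat (int j - 1) = i"
      by simp_all
    with Suc have "ChebU (int j + 1) = [:0, 2:] * ChebU (int j) - ChebU (int j - 1)"
      by (simp add: ChebU_def)
    then show ?thesis
      by (simp only: pcompose_diff pcompose_mult X)
  qed
qed

theorem theorem3p2:
  fixes N k j :: nat and a :: real
  assumes "N \<ge> 1" and "a > 0" and "j \<ge> 1"
  shows "Pstar N a (k + j * N) =
    Pstar N a (k + N) * pcompose (ChebU (int j - 1)) (g N a)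
    - Pstar N a k * pcompose (ChebU (int j - 2)) (g N a)"
proof -
  let ?U = "\<lambda>i. pcompose (ChebU i) (g N a)"
  \<comment> \<open>With \<open>i = j - 1\<close> the indices of U start at \<open>-1\<close>, and
    two-step induction matches the second-order recurrence.\<close>
  have "Pstar N a (k + Suc i * N) = Pstar N a (k + N) * ?U (int i) - Pstar N a k * ?U (int i - 1)"
    for i
  proof (induction i rule: induct_nat_012)
    case 0
    show ?case by (simp add: ChebU_def pcompose_1)
  next
    case 1
    have "?U 1 = 2 * g N a" "?U 0 = 1"
      using pcompose_ChebU_rec[of 0 "g N a"] by (simp_all add: ChebU_def pcompose_1)
    moreover have shift: "Suc (Suc 0) * N = 2 * N"
      by simp
    ultimately show ?case
      using Pstar_double_shift[OF assms(1), of a k] unfolding shift by (simp add: mult.commute)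
  next
    case (ge2 i)
    have shift: "k + Suc (Suc (Suc i)) * N = k + Suc i * N + 2 * N"
      "k + Suc (Suc i) * N = k + Suc i * N + N"
      by simp_all
    have "Pstar N a (k + Suc (Suc (Suc i)) * N)
        = 2 * g N a * Pstar N a (k + Suc (Suc i) * N) - Pstar N a (k + Suc i * N)"
      unfolding shift by (rule Pstar_double_shift[OF assms(1)])
    also have "\<dots> = Pstar N a (k + N) * (2 * g N a * ?U (int (Suc i)) - ?U (int i))
        - Pstar N a k * (2 * g N a * ?U (int i) - ?U (int i - 1))"
      unfolding ge2.IH by (simp add: algebra_simps)
    also have "2 * g N a * ?U (int (Suc i)) - ?U (int i) = ?U (int (Suc (Suc i)))"
      using pcompose_ChebU_rec[of "Suc i" "g N a"] by (simp add: add.commute)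
    also have "2 * g N a * ?U (int i) - ?U (int i - 1) = ?U (int (Suc (Suc i)) - 1)"
      using pcompose_ChebU_rec[of i "g N a"] by (simp add: add.commute)
    finally show ?case .
  qed
  from this[of "j - 1"] show ?thesis
    using assms(3) by (simp add: of_nat_diff)
qed

end
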